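(* Let $T\in\mathcal{A}_n[\mathbb{C}]$ be nonzero with symbol $F_T(z,w)$. If $T\in\mathcal{A}_n^s(\mathbb{C})$, then $F_T(z_1,\ldots,z_n,-w_1,\ldots,-w_n)\neq 0$ whenever $\operatorname{Im}(z_j)\ge 0$ and $\operatorname{Im}(w_k)>0$ for all $1\le j,k\le n$.
   Context: $\mathcal{A}_n[\mathbb{C}]$ is the Weyl algebra of operators $T=\sum_{\alpha,\beta\in\mathbb{N}^n}a_{\alpha\beta}z^\alpha\partial^\beta$ (finite sum, $\partial_i=\partial/\partial z_i$, multi-index notation, $a_{\alpha\beta}\in\mathbb{C}$) on $\mathbb{C}[z_1,\ldots,z_n]$; the symbol of $T$ is $F_T(z,w)=\sum_{\alpha,\beta}a_{\alpha\beta}z^\alpha w^\beta$. A polynomial $g\in\mathbb{C}[z_1,\ldots,z_n]$ is strictly stable if $g(z_1,\ldots,z_n)\neq 0$ for all $(z_1,\ldots,z_n)\in\mathbb{C}^n$ with $\operatorname{Im}(z_j)\ge 0$, $1\le j\le n$; $\mathcal{H}_n^s(\mathbb{C})$ denotes the set of strictly stable polynomials in $n$ variables. $\mathcal{A}_n^s(\mathbb{C})=\{T\in\mathcal{A}_n[\mathbb{C}]: T(\mathcal{H}_n^s(\mathbb{C}))\subseteq\mathcal{H}_n^s(\mathbb{C})\cup\{0\}\}$. *)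

theory Defs
  imports "HOL-Analysis.Finite_Cartesian_Product" "HOL-Library.Poly_Mapping"
begin

text \<open>
  The variables are indexed by a finite type \<open>'n\<close> with \<open>CARD('n) = n\<close>; a polynomial in
  \<open>\<complex>[z\<^sub>1,\<dots>,z\<^sub>n]\<close> is the finitely supported map from multi-indices to coefficients.
\<close>

type_synonym 'n multi_index = "'n \<Rightarrow>\<^sub>0 nat"

type_synonym 'n cpoly = "'n multi_index \<Rightarrow>\<^sub>0 complex"

definition vpow :: "complex ^ 'n \<Rightarrow> 'n::finite multi_index \<Rightarrow> complex" where
  "vpow z \<alpha> = (\<Prod>i\<in>UNIV. (z $ i) ^ Poly_Mapping.lookup \<alpha> i)"

definition eval_cpoly :: "'n::finite cpoly \<Rightarrow> complex ^ 'n \<Rightarrow> complex" where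
  "eval_cpoly p z = (\<Sum>\<alpha>\<in>Poly_Mapping.keys p. Poly_Mapping.lookup p \<alpha> * vpow z \<alpha>)"

definition strictly_stable :: "'n::finite cpoly \<Rightarrow> bool" where
  "strictly_stable g \<longleftrightarrow> (\<forall>z. (\<forall>j. Im (z $ j) \<ge> 0) \<longrightarrow> eval_cpoly g z \<noteq> 0)"

definition strictly_stable_polys :: "'n::finite cpoly set" where
  "strictly_stable_polys = {g. strictly_stable g}"

text \<open>
  Formal partial derivative. The truncated exponent in the case \<open>lookup m i = 0\<close> is
  harmless because the coefficient vanishes there.
\<close>

definition partial :: "'n \<Rightarrow> 'n cpoly \<Rightarrow> 'n cpoly" where
  "partial i p = (\<Sum>m\<in>Poly_Mapping.keys p.
     Poly_Mapping.single (m - Poly_Mapping.single i 1)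
       (of_nat (Poly_Mapping.lookup m i) * Poly_Mapping.lookup p m))"

text \<open>
  \<open>\<partial>\<^sup>\<beta>\<close> is the composition of the operators \<open>\<partial>\<^sub>i\<close>, the \<open>i\<close>-th one taken
  \<open>\<beta>\<^sub>i\<close> times. The fold does not depend on the order because these operators commute
  (\<open>comp_fun_commute_partial\<close> below).
\<close>

definition partial_pow :: "'n::finite multi_index \<Rightarrow> 'n cpoly \<Rightarrow> 'n cpoly" where
  "partial_pow \<beta> p =
     Finite_Set.fold (\<lambda>i. partial i ^^ Poly_Mapping.lookup \<beta> i) p UNIV"

type_synonym 'n weyl_coeffs = "('n multi_index \<times> 'n multi_index) \<Rightarrow>\<^sub>0 complex"

text \<open>
  The operator \<open>\<Sum> a\<^sub>\<alpha>\<^sub>\<beta> z\<^sup>\<alpha> \<partial>\<^sup>\<beta>\<close> on polynomials; the product below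
  is the multiplication of the polynomial ring.
\<close>

definition weyl_operator :: "'n::finite weyl_coeffs \<Rightarrow> 'n cpoly \<Rightarrow> 'n cpoly" where
  "weyl_operator a p = (\<Sum>(\<alpha>, \<beta>)\<in>Poly_Mapping.keys a.
     Poly_Mapping.single \<alpha> (Poly_Mapping.lookup a (\<alpha>, \<beta>)) * partial_pow \<beta> p)"

definition weyl_algebra :: "('n::finite cpoly \<Rightarrow> 'n cpoly) set" where
  "weyl_algebra = range weyl_operator"

text \<open>
  The coefficients of an operator in normal form are unique: see \<open>inj_weyl_operator\<close> and
  \<open>weyl_coeffs_weyl_operator\<close> below.
\<close>

definition weyl_coeffs :: "('n::finite cpoly \<Rightarrow> 'n cpoly) \<Rightarrow> 'n weyl_coeffs" where
  "weyl_coeffs T = (THE a. weyl_operator a = T)"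

definition weyl_symbol ::
    "('n::finite cpoly \<Rightarrow> 'n cpoly) \<Rightarrow> complex ^ 'n \<Rightarrow> complex ^ 'n \<Rightarrow> complex" where
  "weyl_symbol T z w = (\<Sum>(\<alpha>, \<beta>)\<in>Poly_Mapping.keys (weyl_coeffs T).
     Poly_Mapping.lookup (weyl_coeffs T) (\<alpha>, \<beta>) * vpow z \<alpha> * vpow w \<beta>)"

definition strict_stability_preservers :: "('n::finite cpoly \<Rightarrow> 'n cpoly) set" where
  "strict_stability_preservers =
     {T \<in> weyl_algebra. T ` strictly_stable_polys \<subseteq> strictly_stable_polys \<union> {0}}"

subsection \<open>Well-definedness of \<open>partial_pow\<close> and of the coefficients\<close>

lemma lookup_partial:
  fixes p :: "'n cpoly"
  shows "Poly_Mapping.lookup (partial i p) m =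
    of_nat (Suc (Poly_Mapping.lookup m i)) *
      Poly_Mapping.lookup p (m + Poly_Mapping.single i 1)"
proof -
  let ?e = "Poly_Mapping.single i (1::nat)"
  let ?c = "of_nat (Suc (Poly_Mapping.lookup m i)) * Poly_Mapping.lookup p (m + ?e)"
  have "Poly_Mapping.lookup (partial i p) m =
      (\<Sum>k\<in>Poly_Mapping.keys p. if k = m + ?e then ?c else 0)"
    unfolding partial_def lookup_sum
  proof (rule sum.cong[OF refl])
    fix k assume "k \<in> Poly_Mapping.keys p"
    show "Poly_Mapping.lookup (Poly_Mapping.single (k - ?e)
        (of_nat (Poly_Mapping.lookup k i) * Poly_Mapping.lookup p k)) m =
        (if k = m + ?e then ?c else 0)"
    proof (cases "k = m + ?e")
      case True
      then show ?thesis by (simp add: lookup_add)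
    next
      case False
      show ?thesis
      proof (cases "Poly_Mapping.lookup k i = 0")
        case True
        with False show ?thesis by simp
      next
        case pos: False
        have "k - ?e \<noteq> m"
        proof
          assume eq: "k - ?e = m"
          have "k = m + ?e"
          proof (rule poly_mapping_eqI)
            fix j
            show "Poly_Mapping.lookup k j = Poly_Mapping.lookup (m + ?e) j"
              unfolding eq[symmetric] using pos
              by (cases "i = j") (simp_all add: lookup_add lookup_minus lookup_single_not_eq)
          qed
          with False show False by simp
        qed
        with False show ?thesis by (simp add: lookup_single_not_eq)
      qed
    qed
  qed
  also have "\<dots> = ?c"
    by (auto simp: sum.delta in_keys_iff)
  finally show ?thesis .
qed

lemma partial_commute: "partial i (partial j p) = partial j (partial i p)"
proof (cases "i = j")
  case False
  show ?thesis
    by (rule poly_mapping_eqI)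
       (use False in \<open>simp add: lookup_partial lookup_add lookup_single_not_eq ac_simps\<close>)
qed simp

lemma partial_funpow_commute:
  "(partial i ^^ a) ((partial j ^^ b) p) = (partial j ^^ b) ((partial i ^^ a) p)"
proof -
  have *: "partial i ((partial j ^^ b) p) = (partial j ^^ b) (partial i p)" for p
  proof (induction b)
    case (Suc b)
    then show ?case by (simp add: partial_commute[of i j])
  qed simp
  show ?thesis
  proof (induction a)
    case (Suc a)
    then show ?case by (simp add: *)
  qed simp
qed

lemma comp_fun_commute_partial:
  "comp_fun_commute (\<lambda>i. partial i ^^ Poly_Mapping.lookup \<beta> i)"
  by unfold_locales (rule ext, unfold o_apply, rule partial_funpow_commute)

lemma partial_single:
  "partial i (Poly_Mapping.single m c) =
    Poly_Mapping.single (m - Poly_Mapping.single i 1) (of_nat (Poly_Mapping.lookup m i) * c)"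
  by (cases "c = 0") (simp_all add: partial_def)

lemma partial_funpow_single:
  "(partial i ^^ k) (Poly_Mapping.single m c) =
    Poly_Mapping.single (m - Poly_Mapping.single i k)
      (of_nat (\<Prod>j<k. Poly_Mapping.lookup m i - j) * c)"
proof (induction k)
  case (Suc k)
  have "m - Poly_Mapping.single i k - Poly_Mapping.single i 1 = m - Poly_Mapping.single i (Suc k)"
    by (rule poly_mapping_eqI) (simp add: lookup_minus lookup_single when_def)
  with Suc show ?case
    by (simp add: partial_single lookup_minus ac_simps)
qed simp

lemma partial_pow_single:
  fixes \<beta> m :: "'n::finite multi_index"
  shows "partial_pow \<beta> (Poly_Mapping.single m c) =
    Poly_Mapping.single (m - \<beta>)
      (of_nat (\<Prod>i\<in>UNIV. \<Prod>j<Poly_Mapping.lookup \<beta> i. Poly_Mapping.lookup m i - j) * c)"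
proof -
  interpret comp_fun_commute "\<lambda>i. partial i ^^ Poly_Mapping.lookup \<beta> i"
    by (rule comp_fun_commute_partial)
  have "Finite_Set.fold (\<lambda>i. partial i ^^ Poly_Mapping.lookup \<beta> i) (Poly_Mapping.single m c) A =
    Poly_Mapping.single (m - (\<Sum>i\<in>A. Poly_Mapping.single i (Poly_Mapping.lookup \<beta> i)))
      (of_nat (\<Prod>i\<in>A. \<Prod>j<Poly_Mapping.lookup \<beta> i. Poly_Mapping.lookup m i - j) * c)"
    if "finite A" for A :: "'n set"
    using that
  proof induction
    case (insert x A)
    have "Poly_Mapping.lookup
        (\<Sum>i\<in>A. Poly_Mapping.single i (Poly_Mapping.lookup \<beta> i)) x = 0"
      using insert by (auto simp: lookup_sum lookup_single when_def intro!: sum.neutral)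
    moreover have "m - a - b = m - (b + a)" for a b :: "'n multi_index"
      by (simp add: diff_diff_add add.commute)
    ultimately show ?case
      using insert by (simp add: partial_funpow_single lookup_minus ac_simps)
  qed simp
  from this[of UNIV]
  have "partial_pow \<beta> (Poly_Mapping.single m c) =
    Poly_Mapping.single (m - (\<Sum>i\<in>UNIV. Poly_Mapping.single i (Poly_Mapping.lookup \<beta> i)))
      (of_nat (\<Prod>i\<in>UNIV. \<Prod>j<Poly_Mapping.lookup \<beta> i. Poly_Mapping.lookup m i - j) * c)"
    by (simp add: partial_pow_def)
  moreover have "(\<Sum>i\<in>UNIV. Poly_Mapping.single i (Poly_Mapping.lookup \<beta> i)) = \<beta>"
    by (rule poly_mapping_eqI) (simp add: lookup_sum lookup_single when_def)
  ultimately show ?thesis by simp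
qed

lemma partial_pow_single_self:
  fixes m :: "'n::finite multi_index"
  shows "\<exists>d. d \<noteq> 0 \<and> partial_pow m (Poly_Mapping.single m 1) = Poly_Mapping.single 0 d"
proof -
  have "(of_nat (\<Prod>i\<in>UNIV. \<Prod>j<Poly_Mapping.lookup m i. Poly_Mapping.lookup m i - j) :: complex) \<noteq> 0"
    unfolding of_nat_eq_0_iff by (simp add: prod_zero_iff)
  then show ?thesis
    by (intro exI conjI, assumption) (simp only: partial_pow_single cancel_comm_monoid_add_class.diff_cancel mult_1_right)
qed

lemma partial_pow_single_zero:
  fixes \<beta> m :: "'n::finite multi_index"
  assumes "Poly_Mapping.lookup m i < Poly_Mapping.lookup \<beta> i"
  shows "partial_pow \<beta> (Poly_Mapping.single m c) = 0"
proof -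
  have "(\<Prod>j<Poly_Mapping.lookup \<beta> i. Poly_Mapping.lookup m i - j) = 0"
    using assms by (auto simp: prod_zero_iff)
  then have "(\<Prod>i\<in>UNIV. \<Prod>j<Poly_Mapping.lookup \<beta> i. Poly_Mapping.lookup m i - j) = 0"
    by (meson UNIV_I finite prod_zero)
  then show ?thesis
    unfolding partial_pow_single by (simp only: of_nat_0 mult_zero_left single_zero)
qed

lemma weyl_operator_superset:
  assumes "finite K" "Poly_Mapping.keys a \<subseteq> K"
  shows "weyl_operator a p = (\<Sum>(\<alpha>, \<beta>)\<in>K.
     Poly_Mapping.single \<alpha> (Poly_Mapping.lookup a (\<alpha>, \<beta>)) * partial_pow \<beta> p)"
  unfolding weyl_operator_def
  by (rule sum.mono_neutral_left) (use assms in \<open>auto simp: in_keys_iff\<close>)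

lemma inj_weyl_operator: "inj (weyl_operator :: 'n::finite weyl_coeffs \<Rightarrow> _)"
proof (rule injI)
  fix a b :: "'n weyl_coeffs"
  assume eq: "weyl_operator a = weyl_operator b"
  let ?la = "Poly_Mapping.lookup a" and ?lb = "Poly_Mapping.lookup b"
  let ?deg = "\<lambda>\<beta> :: 'n multi_index. \<Sum>i\<in>UNIV. Poly_Mapping.lookup \<beta> i"
  have "?la (\<alpha>, \<beta>) = ?lb (\<alpha>, \<beta>)" for \<alpha> \<beta>
  proof (induction "?deg \<beta>" arbitrary: \<alpha> \<beta> rule: less_induct)
    case less
    define K where "K = Poly_Mapping.keys a \<union> Poly_Mapping.keys b"
    have K: "finite K" "Poly_Mapping.keys a \<subseteq> K" "Poly_Mapping.keys b \<subseteq> K"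
      by (auto simp: K_def)
    let ?p = "Poly_Mapping.single \<beta> (1::complex)"
    let ?t = "\<lambda>(\<gamma>, \<delta>). Poly_Mapping.single \<gamma> (?la (\<gamma>, \<delta>) - ?lb (\<gamma>, \<delta>)) * partial_pow \<delta> ?p"
    obtain d where d: "d \<noteq> 0" "partial_pow \<beta> ?p = Poly_Mapping.single 0 d"
      using partial_pow_single_self by blast
    have "(\<Sum>x\<in>K. ?t x) = weyl_operator a ?p - weyl_operator b ?p"
      by (simp add: weyl_operator_superset[OF K(1,2)] weyl_operator_superset[OF K(1,3)]
          sum_subtractf[symmetric] case_prod_unfold single_diff left_diff_distrib)
    also have "\<dots> = 0" by (simp add: eq)
    finally have zero: "(\<Sum>x\<in>K. ?t x) = 0" .
    have t: "Poly_Mapping.lookup (?t x) \<alpha> =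
        (if x = (\<alpha>, \<beta>) then (?la (\<alpha>, \<beta>) - ?lb (\<alpha>, \<beta>)) * d else 0)" for x
    proof (cases x)
      case (Pair \<gamma> \<delta>)
      consider "\<delta> = \<beta>" | i where "Poly_Mapping.lookup \<beta> i < Poly_Mapping.lookup \<delta> i"
        | "\<delta> \<noteq> \<beta>" "\<forall>i. Poly_Mapping.lookup \<delta> i \<le> Poly_Mapping.lookup \<beta> i"
        by (meson not_le)
      then show ?thesis
      proof cases
        case 1
        then show ?thesis
          by (simp add: Pair d(2) mult_single lookup_single when_def)
      next
        case (2 i)
        then show ?thesis
          by (auto simp: Pair partial_pow_single_zero)
      next
        case 3
        then obtain i where "Poly_Mapping.lookup \<delta> i \<noteq> Poly_Mapping.lookup \<beta> i"
          by (meson poly_mapping_eqI)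
        with 3 have "Poly_Mapping.lookup \<delta> i < Poly_Mapping.lookup \<beta> i"
          by (simp add: le_neq_implies_less)
        then have "?deg \<delta> < ?deg \<beta>"
          using 3 by (intro sum_strict_mono_ex1) auto
        then have "?la (\<gamma>, \<delta>) = ?lb (\<gamma>, \<delta>)"
          by (rule less)
        with 3 show ?thesis by (auto simp: Pair)
      qed
    qed
    have "0 = Poly_Mapping.lookup (\<Sum>x\<in>K. ?t x) \<alpha>"
      by (simp add: zero)
    also have "\<dots> = (if (\<alpha>, \<beta>) \<in> K then (?la (\<alpha>, \<beta>) - ?lb (\<alpha>, \<beta>)) * d else 0)"
      unfolding lookup_sum t using K(1) by simp
    finally show ?case
      using d(1) by (auto simp: K_def in_keys_iff split: if_splits)
  qed
  then show "a = b"
    by (intro poly_mapping_eqI) auto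
qed

lemma weyl_coeffs_weyl_operator: "weyl_coeffs (weyl_operator a) = a"
  unfolding weyl_coeffs_def by (rule the_equality) (simp_all add: inj_eq[OF inj_weyl_operator])

end

theory Submission
  imports Defs "HOL-Complex_Analysis.Great_Picard"
begin

text \<open>
  Test \<open>T\<close> on \<open>f = \<Prod>\<^sub>i (z\<^sub>i - c\<^sub>i)\<^sup>M\<close> with \<open>Im c\<^sub>i < 0\<close> and \<open>M\<close> larger than every exponent
  \<open>\<beta>\<^sub>i\<close> of \<open>T\<close>. If \<open>T f = 0\<close>, then for \<open>g = \<Prod>\<^sub>i (z\<^sub>i - x\<^sub>i)\<^sup>M\<close> with real \<open>x\<close> and small
  \<open>\<epsilon> \<noteq> 0\<close> the polynomial \<open>f + \<epsilon> g\<close> is still strictly stable, while its image \<open>\<epsilon> T g\<close> vanishes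
  at the real point \<open>x\<close>; so \<open>T g = 0\<close> for every real \<open>x\<close>, which forces \<open>T = 0\<close>. Hence
  \<open>T f\<close> has no zero \<open>z\<close> in the closed upper half planes. With \<open>c = z + M / w\<close> the quotient
  \<open>(T f / f)(z)\<close> tends to \<open>F\<^sub>T(z, - w)\<close> as \<open>M \<rightarrow> \<infinity>\<close>, and Hurwitz' theorem in \<open>w\<close>, along a complex line
  on which the limit is not identically zero, gives the claim.
\<close>

subsection \<open>Evaluation\<close>

lemma vpow_zero [simp]: "vpow z 0 = 1"
  by (simp add: vpow_def)

lemma vpow_add: "vpow z (\<alpha> + \<beta>) = vpow z \<alpha> * vpow z \<beta>"
  by (simp add: vpow_def lookup_add power_add prod.distrib)

lemma vpow_single_one [simp]: "vpow z (Poly_Mapping.single i 1) = z $ i"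
proof -
  have "vpow z (Poly_Mapping.single i 1) = (\<Prod>j\<in>UNIV. if j = i then z $ j else 1)"
    unfolding vpow_def by (rule prod.cong) (auto simp: lookup_single when_def)
  then show ?thesis
    by simp
qed

lemma vpow_mult: "vpow (\<chi> i. x $ i * y $ i) \<alpha> = vpow x \<alpha> * vpow y \<alpha>"
  by (simp add: vpow_def power_mult_distrib prod.distrib)

lemma eval_cpoly_superset:
  assumes "finite K" "Poly_Mapping.keys p \<subseteq> K"
  shows "eval_cpoly p z = (\<Sum>\<alpha>\<in>K. Poly_Mapping.lookup p \<alpha> * vpow z \<alpha>)"
  unfolding eval_cpoly_def
  by (rule sum.mono_neutral_left) (use assms in \<open>auto simp: in_keys_iff\<close>)

lemma eval_cpoly_zero [simp]: "eval_cpoly 0 z = 0"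
  by (simp add: eval_cpoly_def)

lemma eval_cpoly_single [simp]: "eval_cpoly (Poly_Mapping.single \<alpha> c) z = c * vpow z \<alpha>"
  by (cases "c = 0") (simp_all add: eval_cpoly_def)

lemma eval_cpoly_add [simp]: "eval_cpoly (p + q) z = eval_cpoly p z + eval_cpoly q z"
proof -
  let ?K = "Poly_Mapping.keys p \<union> Poly_Mapping.keys q"
  have "Poly_Mapping.keys (p + q) \<subseteq> ?K"
    by (rule Poly_Mapping.keys_add)
  then show ?thesis
    by (simp add: eval_cpoly_superset[of ?K] lookup_add distrib_right sum.distrib)
qed

lemma eval_cpoly_diff [simp]: "eval_cpoly (p - q) z = eval_cpoly p z - eval_cpoly q z"
  using eval_cpoly_add[of "p - q" q z] by simp

lemma eval_cpoly_sum: "eval_cpoly (sum f A) z = (\<Sum>x\<in>A. eval_cpoly (f x) z)"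
  by (induction A rule: infinite_finite_induct) simp_all

text \<open>Reduces additive identities to single terms. The step carries no freshness condition on
  \<open>m\<close>, so it combines directly with the distributive laws.\<close>

lemma cpoly_induct [case_names zero single_add]:
  fixes p :: "'n cpoly"
  assumes "P 0" "\<And>m c p. P p \<Longrightarrow> P (Poly_Mapping.single m c + p)"
  shows "P p"
proof (induction p rule: update_induct)
  case const
  show ?case by (rule assms)
next
  case (update f a b)
  \<comment> \<open>The key \<open>a\<close> is new to \<open>f\<close>, so setting its coefficient
    amounts to adding a term.\<close>
  have "Poly_Mapping.update a b f = Poly_Mapping.single a b + f"
    using update by (intro poly_mapping_eqI)
      (auto simp: lookup_update lookup_add lookup_single when_def in_keys_iff)
  with assms(2)[OF update(3)] show ?case by simp
qed

lemma eval_cpoly_mult [simp]: "eval_cpoly (p * q) z = eval_cpoly p z * eval_cpoly q z"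
proof (induction p rule: cpoly_induct)
  case (single_add m c p)
  have "eval_cpoly (Poly_Mapping.single m c * q) z = c * vpow z m * eval_cpoly q z"
  proof (induction q rule: cpoly_induct)
    case (single_add m' c' q)
    then show ?case by (simp add: distrib_left mult_single vpow_add)
  qed simp
  with single_add show ?case by (simp add: distrib_right)
qed simp

lemma eval_cpoly_one [simp]: "eval_cpoly 1 z = 1"
  using eval_cpoly_single[of 0 1 z] by simp

lemma eval_cpoly_power [simp]: "eval_cpoly (p ^ k) z = eval_cpoly p z ^ k"
  by (induction k) simp_all

lemma eval_cpoly_prod: "eval_cpoly (prod f A) z = (\<Prod>x\<in>A. eval_cpoly (f x) z)"
  by (induction A rule: infinite_finite_induct) simp_all

subsection \<open>Differential operators\<close>

lemma partial_zero [simp]: "partial i 0 = 0"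
  by (simp add: partial_def)

lemma partial_add [simp]: "partial i (p + q) = partial i p + partial i q"
  by (rule poly_mapping_eqI) (simp add: lookup_partial lookup_add algebra_simps)

lemma partial_diff [simp]: "partial i (p - q) = partial i p - partial i q"
  using partial_add[of i "p - q" q] by simp

lemma partial_const [simp]: "partial i (Poly_Mapping.single 0 c) = 0"
  by (simp add: partial_single)

lemma partial_one [simp]: "partial i 1 = 0"
  using partial_const[of i 1] by simp

text \<open>Both sides are additive in \<open>p\<close> and in \<open>q\<close>, so two single terms
  suffice; the exponent of the variable \<open>i\<close> in their product is a sum, which gives the
  two summands.\<close>

lemma partial_mult: "partial i (p * q) = partial i p * q + p * partial i q"
proof (induction p rule: cpoly_induct)
  case (single_add m c p)
  have "partial i (Poly_Mapping.single m c * q) =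
    partial i (Poly_Mapping.single m c) * q + Poly_Mapping.single m c * partial i q"
  proof (induction q rule: cpoly_induct)
    case (single_add n d q)
    let ?e = "Poly_Mapping.single i (1::nat)"
    \<comment> \<open>Truncated subtraction commutes with adding \<open>l\<close> only if the
      variable \<open>i\<close> occurs in \<open>k\<close>. If it does not, the coefficient of the
      derivative is 0, hence the case splits below.\<close>
    have shift: "k + l - ?e = k - ?e + l" if "Poly_Mapping.lookup k i \<noteq> 0"
      for k l :: "'a multi_index"
      by (rule poly_mapping_eqI)
        (use that in \<open>auto simp: lookup_add lookup_minus lookup_single when_def\<close>)
    have "partial i (Poly_Mapping.single m c * Poly_Mapping.single n d) =
      Poly_Mapping.single (m + n - ?e) (of_nat (Poly_Mapping.lookup m i) * (c * d)) +
      Poly_Mapping.single (m + n - ?e) (of_nat (Poly_Mapping.lookup n i) * (c * d))"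
      by (simp add: mult_single partial_single lookup_add distrib_right flip: Poly_Mapping.single_add)
    moreover have "Poly_Mapping.single (m + n - ?e) (of_nat (Poly_Mapping.lookup m i) * (c * d)) =
      partial i (Poly_Mapping.single m c) * Poly_Mapping.single n d"
      by (cases "Poly_Mapping.lookup m i = 0")
        (simp_all add: partial_single mult_single mult.assoc shift[unfolded One_nat_def])
    moreover have "Poly_Mapping.single (m + n - ?e) (of_nat (Poly_Mapping.lookup n i) * (c * d)) =
      Poly_Mapping.single m c * partial i (Poly_Mapping.single n d)"
      using shift[of n m]
      by (cases "Poly_Mapping.lookup n i = 0")
        (simp_all add: partial_single mult_single ac_simps)
    ultimately show ?case
      using single_add by (simp add: distrib_left)
  qed simp
  with single_add show ?case by (simp add: distrib_right)
qed simp

lemma partial_const_mult: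
  "partial i (Poly_Mapping.single 0 c * p) = Poly_Mapping.single 0 c * partial i p"
  by (simp add: partial_mult)

lemma partial_pow_add: "partial_pow \<beta> (p + q) = partial_pow \<beta> p + partial_pow \<beta> q"
proof -
  interpret comp_fun_commute "\<lambda>i. partial i ^^ Poly_Mapping.lookup \<beta> i"
    by (rule comp_fun_commute_partial)
  have *: "(partial i ^^ k) (p + q) = (partial i ^^ k) p + (partial i ^^ k) q"
    for i :: 'a and k p q
    by (induction k) simp_all
  have "Finite_Set.fold (\<lambda>i. partial i ^^ Poly_Mapping.lookup \<beta> i) (p + q) A =
    Finite_Set.fold (\<lambda>i. partial i ^^ Poly_Mapping.lookup \<beta> i) p A +
    Finite_Set.fold (\<lambda>i. partial i ^^ Poly_Mapping.lookup \<beta> i) q A" if "finite A" for A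
    using that by induction (simp_all add: *)
  then show ?thesis by (simp add: partial_pow_def)
qed

lemma partial_pow_const_mult:
  "partial_pow \<beta> (Poly_Mapping.single 0 c * p) = Poly_Mapping.single 0 c * partial_pow \<beta> p"
proof -
  interpret comp_fun_commute "\<lambda>i. partial i ^^ Poly_Mapping.lookup \<beta> i"
    by (rule comp_fun_commute_partial)
  have *: "(partial i ^^ k) (Poly_Mapping.single 0 c * p) =
    Poly_Mapping.single 0 c * (partial i ^^ k) p" for i :: 'a and k p
    by (induction k) (simp_all add: partial_const_mult)
  have "Finite_Set.fold (\<lambda>i. partial i ^^ Poly_Mapping.lookup \<beta> i) (Poly_Mapping.single 0 c * p) A =
    Poly_Mapping.single 0 c * Finite_Set.fold (\<lambda>i. partial i ^^ Poly_Mapping.lookup \<beta> i) p A"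
    if "finite A" for A
    using that by induction (simp_all add: *)
  then show ?thesis by (simp add: partial_pow_def)
qed

lemma weyl_operator_add: "weyl_operator a (p + q) = weyl_operator a p + weyl_operator a q"
  by (simp add: weyl_operator_def partial_pow_add distrib_left sum.distrib case_prod_unfold)

lemma weyl_operator_const_mult:
  "weyl_operator a (Poly_Mapping.single 0 c * p) = Poly_Mapping.single 0 c * weyl_operator a p"
  by (simp add: weyl_operator_def partial_pow_const_mult sum_distrib_left case_prod_unfold
      mult.left_commute)

lemma eval_weyl_operator:
  "eval_cpoly (weyl_operator a p) z = (\<Sum>(\<alpha>, \<beta>)\<in>Poly_Mapping.keys a.
     Poly_Mapping.lookup a (\<alpha>, \<beta>) * vpow z \<alpha> * eval_cpoly (partial_pow \<beta> p) z)"
  by (simp add: weyl_operator_def eval_cpoly_sum case_prod_unfold)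

subsection \<open>Powers of linear factors\<close>

definition linear_factor :: "complex ^ 'n \<Rightarrow> 'n \<Rightarrow> 'n::finite cpoly" where
  "linear_factor c i = Poly_Mapping.single (Poly_Mapping.single i 1) 1 - Poly_Mapping.single 0 (c $ i)"

definition linear_power :: "nat \<Rightarrow> complex ^ 'n \<Rightarrow> 'n::finite cpoly" where
  "linear_power M c = (\<Prod>i\<in>UNIV. linear_factor c i ^ M)"

text \<open>The falling factorial \<open>M (M - 1) ... (M - k + 1)\<close>, produced by
  differentiating an \<open>M\<close>-th power \<open>k\<close> times. For \<open>k > M\<close> the
  factor with \<open>j = M\<close> gives the correct value 0.\<close>

definition falling :: "nat \<Rightarrow> nat \<Rightarrow> complex" where
  "falling M k = (\<Prod>j<k. of_nat (M - j))"

definition vfalling :: "nat \<Rightarrow> 'n::finite multi_index \<Rightarrow> complex" where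
  "vfalling M \<beta> = (\<Prod>i\<in>UNIV. falling M (Poly_Mapping.lookup \<beta> i))"

lemma eval_linear_factor [simp]: "eval_cpoly (linear_factor c i) z = z $ i - c $ i"
  using vpow_single_one[of z i] by (simp add: linear_factor_def)

lemma eval_linear_power: "eval_cpoly (linear_power M c) z = (\<Prod>i\<in>UNIV. (z $ i - c $ i) ^ M)"
  by (simp add: linear_power_def eval_cpoly_prod)

lemma partial_linear_factor: "partial i (linear_factor c j) = (if i = j then 1 else 0)"
  by (simp add: linear_factor_def partial_single lookup_single when_def)

lemma partial_linear_factor_power:
  "partial i (linear_factor c i ^ m) = of_nat m * linear_factor c i ^ (m - 1)"
proof (induction m)
  case (Suc m)
  then show ?case
    by (cases m) (simp_all add: partial_mult partial_linear_factor algebra_simps)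
qed simp

lemma partial_linear_factor_power_other:
  "i \<noteq> j \<Longrightarrow> partial i (linear_factor c j ^ m) = 0"
  by (induction m) (simp_all add: partial_mult partial_linear_factor)

lemma partial_prod_eq_0:
  "(\<And>x. x \<in> A \<Longrightarrow> partial i (g x) = 0) \<Longrightarrow> partial i (prod g A) = 0"
  by (induction A rule: infinite_finite_induct) (simp_all add: partial_mult)

text \<open>\<open>h\<close> collects the factors in the other variables, so only the power is
  differentiated. For \<open>k > M\<close> the truncated exponent does no harm, since
  \<open>falling M k = 0\<close>.\<close>

lemma partial_funpow_linear_factor_power:
  assumes "partial i h = 0"
  shows "(partial i ^^ k) (linear_factor c i ^ M * h) =
    Poly_Mapping.single 0 (falling M k) * linear_factor c i ^ (M - k) * h"
proof (induction k)
  case (Suc k)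
  have "Poly_Mapping.single 0 (falling M (Suc k)) =
    Poly_Mapping.single 0 (falling M k) * (of_nat (M - k) :: 'a cpoly)"
    by (simp add: falling_def mult_single flip: single_of_nat)
  then show ?case
    using Suc assms
    by (simp add: partial_mult partial_linear_factor_power mult.assoc)
qed (simp add: falling_def)

lemma partial_pow_linear_power:
  "partial_pow \<beta> (linear_power M c) =
    (\<Prod>i\<in>UNIV. Poly_Mapping.single 0 (falling M (Poly_Mapping.lookup \<beta> i)) *
      linear_factor c i ^ (M - Poly_Mapping.lookup \<beta> i))"
proof -
  interpret comp_fun_commute "\<lambda>i. partial i ^^ Poly_Mapping.lookup \<beta> i"
    by (rule comp_fun_commute_partial)
  let ?D = "\<lambda>i. Poly_Mapping.single 0 (falling M (Poly_Mapping.lookup \<beta> i)) *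
      linear_factor c i ^ (M - Poly_Mapping.lookup \<beta> i)"
  \<comment> \<open>\<open>A\<close> is the set of variables that the fold has already treated; the
    factors outside \<open>A\<close> still carry their full power.\<close>
  have "Finite_Set.fold (\<lambda>i. partial i ^^ Poly_Mapping.lookup \<beta> i) (linear_power M c) A =
    (\<Prod>i\<in>A. ?D i) * (\<Prod>i\<in>-A. linear_factor c i ^ M)" if "finite A" for A
    using that
  proof induction
    case (insert x A)
    let ?P = "\<Prod>i\<in>A. ?D i" and ?Q = "\<Prod>i\<in>- insert x A. linear_factor c i ^ M"
    have "- A = insert x (- insert x A)"
      using insert by auto
    then have Q: "(\<Prod>i\<in>-A. linear_factor c i ^ M) = linear_factor c x ^ M * ?Q"
      by (metis (no_types, lifting) ComplD finite_code insertI1 prod.insert)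
    have "partial x (?D i) = 0" if "i \<in> A" for i
    proof -
      have "x \<noteq> i"
        using that insert by auto
      then show ?thesis
        using partial_linear_factor_power_other[of x i c "M - Poly_Mapping.lookup \<beta> i"] by (simp add: partial_const_mult)
    qed
    then have "partial x ?P = 0"
      by (rule partial_prod_eq_0)
    moreover have "partial x ?Q = 0"
      by (rule partial_prod_eq_0) (auto intro: partial_linear_factor_power_other)
    ultimately have "partial x (?P * ?Q) = 0"
      by (simp only: partial_mult) simp
    note step = partial_funpow_linear_factor_power[OF this, of "Poly_Mapping.lookup \<beta> x" c M]
    have "Finite_Set.fold (\<lambda>i. partial i ^^ Poly_Mapping.lookup \<beta> i) (linear_power M c) (insert x A) =
      (partial x ^^ Poly_Mapping.lookup \<beta> x) (linear_factor c x ^ M * (?P * ?Q))"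
      by (simp only: fold_insert[OF insert(1,2)] insert(3) Q mult.left_commute)
    then show ?case
      by (simp only: step prod.insert[OF insert(1,2)] mult.assoc)
  qed (simp add: linear_power_def)
  from this[of UNIV] show ?thesis
    by (simp add: partial_pow_def)
qed

lemma eval_partial_pow_linear_power:
  "eval_cpoly (partial_pow \<beta> (linear_power M c)) z =
    vfalling M \<beta> * (\<Prod>i\<in>UNIV. (z $ i - c $ i) ^ (M - Poly_Mapping.lookup \<beta> i))"
  by (simp add: partial_pow_linear_power eval_cpoly_prod prod.distrib vfalling_def)

text \<open>\<open>M\<close> exceeds every order of differentiation that occurs, so each derivative
  keeps a positive power of the linear factors, which vanish at \<open>z\<close>.\<close>

lemma eval_weyl_operator_linear_power_self:
  fixes a :: "'n::finite weyl_coeffs"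
  assumes "\<And>\<alpha> \<beta> i. (\<alpha>, \<beta>) \<in> Poly_Mapping.keys a \<Longrightarrow> Poly_Mapping.lookup \<beta> i < M"
  shows "eval_cpoly (weyl_operator a (linear_power M z)) z = 0"
  unfolding eval_weyl_operator
proof (rule sum.neutral, safe)
  fix \<alpha> \<beta> assume "(\<alpha>, \<beta>) \<in> Poly_Mapping.keys a"
  from assms[OF this] show "Poly_Mapping.lookup a (\<alpha>, \<beta>) * vpow z \<alpha> *
      eval_cpoly (partial_pow \<beta> (linear_power M z)) z = 0"
    by (simp add: eval_partial_pow_linear_power power_0_left not_le)
qed

text \<open>\<open>s\<close> is the coordinatewise inverse of \<open>z - c\<close>. Pulling out the
  full \<open>M\<close>-th powers turns each derivative into
  \<open>vfalling M \<beta> * vpow s \<beta>\<close>, which leaves a weighted symbol at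
  \<open>(z, s)\<close>.\<close>

lemma eval_weyl_operator_linear_power:
  fixes a :: "'n::finite weyl_coeffs"
  assumes deg: "\<And>\<alpha> \<beta> i. (\<alpha>, \<beta>) \<in> Poly_Mapping.keys a \<Longrightarrow> Poly_Mapping.lookup \<beta> i < M"
    and s: "\<And>i. (z $ i - c $ i) * s $ i = 1"
  shows "eval_cpoly (weyl_operator a (linear_power M c)) z =
    (\<Prod>i\<in>UNIV. (z $ i - c $ i) ^ M) * (\<Sum>(\<alpha>, \<beta>)\<in>Poly_Mapping.keys a.
      Poly_Mapping.lookup a (\<alpha>, \<beta>) * vpow z \<alpha> * (vfalling M \<beta> * vpow s \<beta>))"
  unfolding eval_weyl_operator sum_distrib_left
proof (rule sum.cong[OF refl], safe)
  fix \<alpha> \<beta> assume "(\<alpha>, \<beta>) \<in> Poly_Mapping.keys a"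
  note less = deg[OF this]
  have "(z $ i - c $ i) ^ M * (s $ i) ^ Poly_Mapping.lookup \<beta> i =
      (z $ i - c $ i) ^ (M - Poly_Mapping.lookup \<beta> i)" for i
  proof -
    have "(z $ i - c $ i) ^ M = (z $ i - c $ i) ^ (M - Poly_Mapping.lookup \<beta> i) *
        (z $ i - c $ i) ^ Poly_Mapping.lookup \<beta> i"
      using less[of i] by (simp flip: power_add)
    moreover have "(z $ i - c $ i) ^ Poly_Mapping.lookup \<beta> i * (s $ i) ^ Poly_Mapping.lookup \<beta> i = 1"
      using s[of i] by (simp flip: power_mult_distrib)
    ultimately show ?thesis
      by (simp add: mult.assoc)
  qed
  then have "(\<Prod>i\<in>UNIV. (z $ i - c $ i) ^ M) * vpow s \<beta> =
      (\<Prod>i\<in>UNIV. (z $ i - c $ i) ^ (M - Poly_Mapping.lookup \<beta> i))"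
    by (simp add: vpow_def flip: prod.distrib)
  then show "Poly_Mapping.lookup a (\<alpha>, \<beta>) * vpow z \<alpha> * eval_cpoly (partial_pow \<beta> (linear_power M c)) z =
    (\<Prod>i\<in>UNIV. (z $ i - c $ i) ^ M) *
     (Poly_Mapping.lookup a (\<alpha>, \<beta>) * vpow z \<alpha> * (vfalling M \<beta> * vpow s \<beta>))"
    by (simp add: eval_partial_pow_linear_power algebra_simps)
qed

lemma vfalling_nonzero:
  assumes "\<And>i. Poly_Mapping.lookup \<beta> i \<le> M"
  shows "vfalling M \<beta> \<noteq> 0"
proof -
  have "falling M (Poly_Mapping.lookup \<beta> i) \<noteq> 0" for i
    using assms[of i] by (simp add: falling_def prod_zero_iff)
  then show ?thesis
    by (simp add: vfalling_def)
qed

text \<open>Each of the \<open>k\<close> factors, divided by \<open>M\<close>, tends to 1.\<close>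

lemma tendsto_falling: "(\<lambda>M. falling M k * (1 / of_nat M) ^ k) \<longlonglongrightarrow> 1"
proof (induction k)
  case (Suc k)
  have "(\<lambda>M. 1 - of_nat k * (1 / of_nat M)) \<longlonglongrightarrow> (1 - of_nat k * 0 :: complex)"
    by (intro tendsto_intros lim_1_over_n)
  \<comment> \<open>From \<open>Suc k\<close> on, the natural subtraction \<open>M - k\<close> is
    exact and \<open>M\<close> is nonzero.\<close>
  moreover have "\<forall>\<^sub>F M in sequentially.
      1 - of_nat k * (1 / of_nat M) = (of_nat (M - k) * (1 / of_nat M) :: complex)"
    by (rule eventually_sequentiallyI[of "Suc k"]) (simp add: of_nat_diff field_simps)
  ultimately have "(\<lambda>M. of_nat (M - k) * (1 / of_nat M) :: complex) \<longlonglongrightarrow> 1"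
    by (simp add: tendsto_cong)
  from tendsto_mult[OF Suc this] show ?case
    by (simp add: falling_def ac_simps)
qed (simp add: falling_def)

lemma tendsto_vfalling:
  fixes \<beta> :: "'n::finite multi_index"
  shows "(\<lambda>M. vfalling M \<beta> * vpow (\<chi> i. 1 / of_nat M) \<beta>) \<longlonglongrightarrow> 1"
proof -
  have "(\<lambda>M. \<Prod>i\<in>UNIV. falling M (Poly_Mapping.lookup \<beta> i) *
      (1 / of_nat M) ^ Poly_Mapping.lookup \<beta> i) \<longlonglongrightarrow> (\<Prod>i\<in>(UNIV :: 'n set). 1)"
    by (rule tendsto_prod) (rule tendsto_falling)
  then show ?thesis
    by (simp add: vfalling_def vpow_def prod.distrib)
qed

subsection \<open>Independence of monomials\<close>

text \<open>Induction on \<open>S\<close>: rescaling one coordinate and subtracting a multiple of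
  the original relation eliminates the new monomial \<open>b\<close>. Nonzero real points are
  enough, and they are closed under this rescaling.\<close>

lemma vpow_independent:
  fixes q :: "'n::finite multi_index \<Rightarrow> complex"
  assumes "finite S" "\<beta> \<in> S"
    and "\<And>w. (\<And>j. w $ j \<in> \<real> - {0}) \<Longrightarrow> (\<Sum>\<beta>\<in>S. q \<beta> * vpow w \<beta>) = 0"
  shows "q \<beta> = 0"
  using assms
proof (induction S arbitrary: q \<beta>)
  case (insert b S)
  have zero: "q \<beta> = 0" if "\<beta> \<in> S" for \<beta>
  proof -
    from that insert have "\<beta> \<noteq> b" by auto
    then obtain i where i: "Poly_Mapping.lookup \<beta> i \<noteq> Poly_Mapping.lookup b i"
      by (meson poly_mapping_eqI)
    \<comment> \<open>Doubling a coordinate in which \<open>\<beta>\<close> and \<open>b\<close>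
      differ separates the two monomials, as their factors are distinct powers of 2.\<close>
    define e :: "complex ^ 'n" where "e = (\<chi> j. if j = i then 2 else 1)"
    have e: "vpow e \<gamma> = 2 ^ Poly_Mapping.lookup \<gamma> i" for \<gamma>
      by (simp add: vpow_def e_def if_distrib[of "\<lambda>x. x ^ _"] cong: if_cong)
    have "q \<beta> * (vpow e \<beta> - vpow e b) = 0"
    proof (rule insert.IH[OF that])
      fix w :: "complex ^ 'n" assume w: "\<And>j. w $ j \<in> \<real> - {0}"
      have "(\<Sum>\<beta>\<in>S. q \<beta> * (vpow e \<beta> - vpow e b) * vpow w \<beta>) =
        (\<Sum>\<beta>\<in>insert b S. q \<beta> * (vpow e \<beta> - vpow e b) * vpow w \<beta>)"
        using insert by simp
      also have "\<dots> = (\<Sum>\<beta>\<in>insert b S. q \<beta> * vpow (\<chi> j. e $ j * w $ j) \<beta>) -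
        vpow e b * (\<Sum>\<beta>\<in>insert b S. q \<beta> * vpow w \<beta>)"
        unfolding vpow_mult sum_distrib_left sum_subtractf[symmetric]
        by (rule sum.cong) (simp_all add: algebra_simps)
      also have "(\<Sum>\<beta>\<in>insert b S. q \<beta> * vpow w \<beta>) = 0"
        by (rule insert.prems) (rule w)
      also have "(\<Sum>\<beta>\<in>insert b S. q \<beta> * vpow (\<chi> j. e $ j * w $ j) \<beta>) = 0"
        by (rule insert.prems) (use w in \<open>auto simp: e_def\<close>)
      finally show "(\<Sum>\<beta>\<in>S. q \<beta> * (vpow e \<beta> - vpow e b) * vpow w \<beta>) = 0"
        by simp
    qed
    moreover have "vpow e \<beta> \<noteq> vpow e b"
    proof
      assume "vpow e \<beta> = vpow e b"
      then have "of_nat (2 ^ Poly_Mapping.lookup \<beta> i) = (of_nat (2 ^ Poly_Mapping.lookup b i) :: complex)"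
        by (simp add: e)
      then show False
        using i unfolding of_nat_eq_iff by simp
    qed
    ultimately show ?thesis by simp
  qed
  \<comment> \<open>With all other coefficients known to vanish, evaluation at the all-ones vector
    isolates \<open>q b\<close>.\<close>
  have "(\<Sum>\<beta>\<in>insert b S. q \<beta> * vpow 1 \<beta>) = 0"
    by (rule insert.prems) auto
  moreover have "vpow (1 :: complex ^ 'n) b = 1"
    by (simp add: vpow_def)
  ultimately have "q b = 0"
    using insert zero by simp
  with zero insert show ?case by auto
qed simp

text \<open>Extending the support to the rectangle of its two projections adds only zero terms, and
  there the sums may be swapped. The result is ordered by \<open>\<beta>\<close>, ready for
  comparing coefficients.\<close>

lemma sum_keys_regroup:
  fixes a :: "'n::finite weyl_coeffs"
  shows "(\<Sum>(\<alpha>, \<beta>)\<in>Poly_Mapping.keys a. Poly_Mapping.lookup a (\<alpha>, \<beta>) * u \<alpha> * v \<beta>) =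
    (\<Sum>\<beta>\<in>snd ` Poly_Mapping.keys a.
      (\<Sum>\<alpha>\<in>fst ` Poly_Mapping.keys a. Poly_Mapping.lookup a (\<alpha>, \<beta>) * u \<alpha>) * v \<beta>)"
proof -
  let ?A = "fst ` Poly_Mapping.keys a" and ?B = "snd ` Poly_Mapping.keys a"
  have "(\<Sum>(\<alpha>, \<beta>)\<in>Poly_Mapping.keys a. Poly_Mapping.lookup a (\<alpha>, \<beta>) * u \<alpha> * v \<beta>) =
    (\<Sum>(\<alpha>, \<beta>)\<in>?A \<times> ?B. Poly_Mapping.lookup a (\<alpha>, \<beta>) * u \<alpha> * v \<beta>)"
    by (rule sum.mono_neutral_left) (auto simp: in_keys_iff, force simp: in_keys_iff, force simp: in_keys_iff)
  also have "\<dots> = (\<Sum>\<beta>\<in>?B. \<Sum>\<alpha>\<in>?A. Poly_Mapping.lookup a (\<alpha>, \<beta>) * u \<alpha> * v \<beta>)"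
    unfolding sum.cartesian_product[symmetric] by (rule sum.swap)
  finally show ?thesis
    by (simp only: sum_distrib_right)
qed

text \<open>Independence of the monomials in \<open>w\<close> alone, with \<open>u\<close> fixed.
  The weight \<open>h\<close> covers both the falling factorials and the unweighted symbol.\<close>

lemma sum_keys_eq_0_imp:
  fixes a :: "'n::finite weyl_coeffs"
  assumes "\<And>w. (\<And>j. w $ j \<in> \<real> - {0}) \<Longrightarrow>
      (\<Sum>(\<alpha>, \<beta>)\<in>Poly_Mapping.keys a. Poly_Mapping.lookup a (\<alpha>, \<beta>) * u \<alpha> * (h \<beta> * vpow w \<beta>)) = 0"
    and "\<beta> \<in> snd ` Poly_Mapping.keys a" "h \<beta> \<noteq> 0"
  shows "(\<Sum>\<alpha>\<in>fst ` Poly_Mapping.keys a. Poly_Mapping.lookup a (\<alpha>, \<beta>) * u \<alpha>) = 0"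
proof -
  have "(\<Sum>\<alpha>\<in>fst ` Poly_Mapping.keys a. Poly_Mapping.lookup a (\<alpha>, \<beta>) * u \<alpha>) * h \<beta> = 0"
  proof (rule vpow_independent[OF _ assms(2)])
    fix w :: "complex ^ 'n" assume "\<And>j. w $ j \<in> \<real> - {0}"
    from assms(1)[OF this] show "(\<Sum>\<beta>\<in>snd ` Poly_Mapping.keys a.
      (\<Sum>\<alpha>\<in>fst ` Poly_Mapping.keys a. Poly_Mapping.lookup a (\<alpha>, \<beta>) * u \<alpha>) * h \<beta> * vpow w \<beta>) = 0"
      unfolding sum_keys_regroup by (simp add: mult.assoc)
  qed simp
  with assms(3) show ?thesis by simp
qed

text \<open>Monomial independence is applied twice, first in \<open>w\<close> for fixed
  \<open>z\<close>, then in \<open>z\<close>.\<close>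

lemma weyl_coeffs_eq_0I:
  fixes a :: "'n::finite weyl_coeffs"
  assumes sum0: "\<And>z w. (\<And>j. z $ j \<in> \<real> - {0}) \<Longrightarrow> (\<And>j. w $ j \<in> \<real> - {0}) \<Longrightarrow>
      (\<Sum>(\<alpha>, \<beta>)\<in>Poly_Mapping.keys a.
        Poly_Mapping.lookup a (\<alpha>, \<beta>) * vpow z \<alpha> * (h \<beta> * vpow w \<beta>)) = 0"
    and h: "\<And>\<alpha> \<beta>. (\<alpha>, \<beta>) \<in> Poly_Mapping.keys a \<Longrightarrow> h \<beta> \<noteq> 0"
  shows "a = 0"
proof -
  have False if ab: "(\<alpha>, \<beta>) \<in> Poly_Mapping.keys a" for \<alpha> \<beta>
  proof -
    have "Poly_Mapping.lookup a (\<alpha>, \<beta>) = 0"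
    proof (rule vpow_independent[where S = "fst ` Poly_Mapping.keys a" and
          q = "\<lambda>\<alpha>. Poly_Mapping.lookup a (\<alpha>, \<beta>)"])
      show "\<alpha> \<in> fst ` Poly_Mapping.keys a"
        using ab by force
      have "\<beta> \<in> snd ` Poly_Mapping.keys a"
        using ab by force
      then show "(\<Sum>\<alpha>\<in>fst ` Poly_Mapping.keys a. Poly_Mapping.lookup a (\<alpha>, \<beta>) * vpow z \<alpha>) = 0"
        if "\<And>j. z $ j \<in> \<real> - {0}" for z
        using sum_keys_eq_0_imp[of a "vpow z" h \<beta>] sum0[OF that] h[OF ab] by blast
    qed simp
    with ab show False by (simp add: in_keys_iff)
  qed
  then show ?thesis
    by (metis keys_eq_empty equals0I surj_pair)
qed

subsection \<open>Strictly stable test polynomials\<close>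

lemma strictly_stable_linear_power:
  assumes "\<And>i. Im (c $ i) < 0"
  shows "strictly_stable (linear_power M c)"
proof -
  have "z $ i \<noteq> c $ i" if "\<And>j. Im (z $ j) \<ge> 0" for z i
    using assms[of i] that[of i] by auto
  then show ?thesis
    by (auto simp: strictly_stable_def eval_linear_power)
qed

text \<open>On the closed upper half planes the quotient of the two products is bounded.\<close>

lemma strictly_stable_perturbation:
  fixes c x :: "complex ^ 'n::finite"
  assumes c: "\<And>i. Im (c $ i) < 0"
  shows "\<exists>\<epsilon>. \<epsilon> \<noteq> 0 \<and> strictly_stable (linear_power M c + Poly_Mapping.single 0 \<epsilon> * linear_power M x)"
proof -
  \<comment> \<open>From \<open>|z_i - x_i| \<le> |z_i - c_i| + |x_i - c_i|\<close> and
    \<open>|z_i - c_i| \<ge> - Im c_i\<close> on the closed upper half plane, \<open>B i\<close>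
    bounds the ratio of the two linear factors.\<close>
  define B where "B i = 1 + norm (x $ i - c $ i) / (- Im (c $ i))" for i
  have B: "B i > 0" for i
    using c[of i] by (simp add: B_def add_pos_nonneg divide_nonneg_neg del: divide_minus_right)
  define C where "C = (\<Prod>i\<in>UNIV. B i ^ M)"
  have C: "C > 0"
    by (simp add: C_def B prod_pos)
  \<comment> \<open>With \<open>\<epsilon> = 1 / (2 C)\<close> the perturbation has at most half the
    modulus of the main term, so the sum cannot vanish.\<close>
  have "eval_cpoly (linear_power M c + Poly_Mapping.single 0 (of_real (1 / (2 * C))) * linear_power M x) z \<noteq> 0"
    if z: "\<And>j. Im (z $ j) \<ge> 0" for z
  proof
    have le: "norm (z $ i - x $ i) \<le> norm (z $ i - c $ i) * B i" for i
    proof -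
      have "- Im (c $ i) \<le> \<bar>Im (z $ i - c $ i)\<bar>"
        using z[of i] c[of i] by simp
      also have "\<dots> \<le> norm (z $ i - c $ i)"
        by (rule abs_Im_le_cmod)
      finally have "norm (x $ i - c $ i) \<le> norm (z $ i - c $ i) * (norm (x $ i - c $ i) / (- Im (c $ i)))"
        using c[of i] mult_right_mono[of "- Im (c $ i)" "norm (z $ i - c $ i)" "norm (x $ i - c $ i)"]
        by (simp add: field_simps)
      moreover have "norm (z $ i - x $ i) \<le> norm (z $ i - c $ i) + norm (x $ i - c $ i)"
        using norm_triangle_ineq4[of "z $ i - c $ i" "x $ i - c $ i"] by simp
      ultimately show ?thesis
        by (simp add: B_def distrib_left del: divide_minus_right)
    qed
    let ?f = "eval_cpoly (linear_power M c) z" and ?g = "eval_cpoly (linear_power M x) z"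
    have "norm ?g = (\<Prod>i\<in>UNIV. norm (z $ i - x $ i) ^ M)"
      by (simp add: eval_linear_power prod_norm[symmetric] norm_power)
    also have "\<dots> \<le> (\<Prod>i\<in>UNIV. (norm (z $ i - c $ i) * B i) ^ M)"
      by (intro prod_mono conjI power_mono le) auto
    also have "\<dots> = norm ?f * C"
      by (simp add: eval_linear_power prod_norm[symmetric] norm_power C_def power_mult_distrib prod.distrib)
    finally have "norm ?g \<le> norm ?f * C" .
    moreover assume "eval_cpoly (linear_power M c + Poly_Mapping.single 0 (of_real (1 / (2 * C))) * linear_power M x) z = 0"
    then have "?f = - (of_real (1 / (2 * C)) * ?g)"
      by (simp add: eq_neg_iff_add_eq_0)
    then have "norm ?f = norm ?g / (2 * C)"
      using C by (simp add: norm_divide norm_mult)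
    moreover have "norm ?f > 0"
      using strictly_stable_linear_power[OF c, of M] z by (simp add: strictly_stable_def)
    ultimately show False
      using C by (simp add: field_simps)
  qed
  moreover have "of_real (1 / (2 * C)) \<noteq> (0 :: complex)"
    using C by simp
  ultimately show ?thesis
    unfolding strictly_stable_def by blast
qed

lemma weyl_operator_linear_power_nonzero:
  fixes a :: "'n::finite weyl_coeffs"
  assumes "a \<noteq> 0"
    and deg: "\<And>\<alpha> \<beta> i. (\<alpha>, \<beta>) \<in> Poly_Mapping.keys a \<Longrightarrow> Poly_Mapping.lookup \<beta> i < M"
    and pres: "\<And>g. strictly_stable g \<Longrightarrow> strictly_stable (weyl_operator a g) \<or> weyl_operator a g = 0"
    and c: "\<And>i. Im (c $ i) < 0"
  shows "weyl_operator a (linear_power M c) \<noteq> 0"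
proof
  assume zero: "weyl_operator a (linear_power M c) = 0"
  have vanish: "eval_cpoly (weyl_operator a (linear_power M x)) z = 0"
    if x: "\<And>i. Im (x $ i) = 0" for x z
  proof -
    obtain \<epsilon> where \<epsilon>: "\<epsilon> \<noteq> 0"
      "strictly_stable (linear_power M c + Poly_Mapping.single 0 \<epsilon> * linear_power M x)"
      using strictly_stable_perturbation[OF c] by blast
    let ?p = "Poly_Mapping.single 0 \<epsilon> * weyl_operator a (linear_power M x)"
    have "strictly_stable ?p \<or> ?p = 0"
      using pres[OF \<epsilon>(2)] by (simp add: weyl_operator_add weyl_operator_const_mult zero)
    \<comment> \<open>The real point \<open>x\<close> lies in the closed upper half planes, so a
      zero there rules out strict stability and only \<open>?p = 0\<close> remains.\<close>
    moreover have "eval_cpoly ?p x = 0"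
      using eval_weyl_operator_linear_power_self[OF deg] by simp
    ultimately have "?p = 0"
      using x by (auto simp: strictly_stable_def)
    then have "eval_cpoly ?p z = 0" by simp
    with \<epsilon>(1) show ?thesis by simp
  qed
  have "a = 0"
  proof (rule weyl_coeffs_eq_0I[where h = "vfalling M"])
    fix z w :: "complex ^ 'n"
    assume z: "\<And>j. z $ j \<in> \<real> - {0}" and w: "\<And>j. w $ j \<in> \<real> - {0}"
    \<comment> \<open>This real \<open>x\<close> makes \<open>w\<close> the coordinatewise inverse
      of \<open>z - x\<close>, so the vanishing of the image at \<open>z\<close> becomes a relation
      between monomials in \<open>z\<close> and \<open>w\<close>.\<close>
    define x where "x = (\<chi> i. z $ i - 1 / w $ i)"
    have inv: "(z $ i - x $ i) * w $ i = 1" for i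
      using w[of i] by (simp add: x_def)
    have "x $ i \<in> \<real>" for i
      using w[of i] z[of i] by (simp add: x_def)
    then have "Im (x $ i) = 0" for i
      by (simp add: complex_is_Real_iff)
    then have "eval_cpoly (weyl_operator a (linear_power M x)) z = 0"
      by (rule vanish)
    then have "(\<Prod>i\<in>UNIV. (z $ i - x $ i) ^ M) * (\<Sum>(\<alpha>, \<beta>)\<in>Poly_Mapping.keys a.
      Poly_Mapping.lookup a (\<alpha>, \<beta>) * vpow z \<alpha> * (vfalling M \<beta> * vpow w \<beta>)) = 0"
      by (simp only: eval_weyl_operator_linear_power[OF deg inv])
    moreover have "z $ i - x $ i \<noteq> 0" for i
      using inv[of i] by auto
    then have "(\<Prod>i\<in>UNIV. (z $ i - x $ i) ^ M) \<noteq> 0"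
      by (simp add: prod_zero_iff)
    ultimately show "(\<Sum>(\<alpha>, \<beta>)\<in>Poly_Mapping.keys a.
      Poly_Mapping.lookup a (\<alpha>, \<beta>) * vpow z \<alpha> * (vfalling M \<beta> * vpow w \<beta>)) = 0"
      by simp
  qed (rule vfalling_nonzero, rule less_imp_le, rule deg)
  with \<open>a \<noteq> 0\<close> show False ..
qed

subsection \<open>Passage to the limit\<close>

text \<open>The coefficients do not depend on \<open>x\<close>, so their convergence is uniform;
  bounded factors and finite sums preserve this.\<close>

lemma uniform_limit_coeff_sum:
  fixes f :: "'k \<Rightarrow> 'a \<Rightarrow> complex"
  assumes "finite K" "\<And>k. k \<in> K \<Longrightarrow> (\<lambda>n. c n k) \<longlonglongrightarrow> d k"
    and "\<And>k. k \<in> K \<Longrightarrow> bounded (f k ` X)"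
  shows "uniform_limit X (\<lambda>n x. \<Sum>k\<in>K. c n k * f k x) (\<lambda>x. \<Sum>k\<in>K. d k * f k x) sequentially"
  using assms
proof (induction K)
  case (insert k K)
  have "uniform_limit X (\<lambda>n x. c n k) (\<lambda>x. d k) sequentially"
    using insert.prems(1)[of k]
    by (auto simp: uniform_limit_iff tendsto_iff elim: eventually_mono)
  then have "uniform_limit X (\<lambda>n x. c n k * f k x) (\<lambda>x. d k * f k x) sequentially"
    using insert.prems(2)[of k] bounded_subset[of "{d k}" "(\<lambda>x. d k) ` X"]
    by (intro uniform_lim_mult uniform_limit_const) auto
  with insert show ?case
    by (simp add: uniform_limit_add)
qed (simp add: uniform_limit_const)

text \<open>
  For fixed \<open>z\<close> the choice \<open>c = z + M / w\<close> makes \<open>1 / (z - c)\<close> equal to \<open>- w / M\<close>,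
  so the test polynomial yields a rescaled symbol at \<open>- w\<close>.
\<close>

lemma rescaled_symbol_nonzero:
  fixes a :: "'n::finite weyl_coeffs"
  assumes "a \<noteq> 0" "M > 0"
    and deg: "\<And>\<alpha> \<beta> i. (\<alpha>, \<beta>) \<in> Poly_Mapping.keys a \<Longrightarrow> Poly_Mapping.lookup \<beta> i < M"
    and pres: "\<And>g. strictly_stable g \<Longrightarrow> strictly_stable (weyl_operator a g) \<or> weyl_operator a g = 0"
    and z: "\<And>i. Im (z $ i) \<ge> 0" and w: "\<And>i. w $ i \<noteq> 0"
    and M: "\<And>i. Im (z $ i + of_nat M / w $ i) < 0"
  shows "(\<Sum>(\<alpha>, \<beta>)\<in>Poly_Mapping.keys a. Poly_Mapping.lookup a (\<alpha>, \<beta>) * vpow z \<alpha> *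
    (vfalling M \<beta> * vpow (\<chi> i. 1 / of_nat M) \<beta> * vpow (- w) \<beta>)) \<noteq> 0"
proof -
  define c where "c = (\<chi> i. z $ i + of_nat M / w $ i)"
  define s where "s = (\<chi> i. 1 / of_nat M * (- w) $ i)"
  have c: "Im (c $ i) < 0" for i
    using M[of i] by (simp add: c_def)
  have inv: "(z $ i - c $ i) * s $ i = 1" for i
    using w[of i] \<open>M > 0\<close> by (simp add: c_def s_def)
  have vpow_s: "vpow s \<beta> = vpow (\<chi> i. 1 / of_nat M) \<beta> * vpow (- w) \<beta>" for \<beta>
    using vpow_mult[of "\<chi> i. 1 / of_nat M" "- w" \<beta>] by (simp add: s_def)
  have "weyl_operator a (linear_power M c) \<noteq> 0"
    by (rule weyl_operator_linear_power_nonzero[OF \<open>a \<noteq> 0\<close> deg pres c])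
  with pres[OF strictly_stable_linear_power[OF c, of M]]
  have "strictly_stable (weyl_operator a (linear_power M c))"
    by simp
  then have "eval_cpoly (weyl_operator a (linear_power M c)) z \<noteq> 0"
    using z by (simp add: strictly_stable_def)
  then show ?thesis
    by (simp add: eval_weyl_operator_linear_power[OF deg inv] vpow_s mult.assoc)
qed

lemma holomorphic_on_vpow:
  assumes "\<And>i. (\<lambda>t. f t $ i) holomorphic_on S"
  shows "(\<lambda>t. vpow (f t) \<alpha>) holomorphic_on S"
  unfolding vpow_def by (rule holomorphic_on_prod) (rule holomorphic_on_power, rule assms)

text \<open>\<open>1 / w t\<close> has negative imaginary part, bounded away from 0 by compactness,
  so a single threshold for \<open>M\<close> outweighs \<open>Im z\<close> for all \<open>t\<close>
  in \<open>K\<close>.\<close>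

lemma eventually_Im_add_divide_neg:
  fixes w :: "complex \<Rightarrow> complex"
  assumes "compact K" "continuous_on K w" "\<And>t. t \<in> K \<Longrightarrow> Im (w t) > 0"
  shows "\<forall>\<^sub>F M in sequentially. \<forall>t\<in>K. Im (z + of_nat M / w t) < 0"
proof (cases "K = {}")
  case False
  let ?h = "\<lambda>t. Im (1 / w t)"
  have "continuous_on K ?h"
    using assms by (fastforce intro!: continuous_intros)
  from continuous_attains_sup[OF assms(1) False this]
  obtain t0 where t0: "t0 \<in> K" "\<And>t. t \<in> K \<Longrightarrow> ?h t \<le> ?h t0"
    by blast
  have "?h t0 < 0"
    using assms(3)[OF t0(1)] by (simp add: Im_divide divide_neg_pos sum_power2_gt_zero_iff)
  obtain N :: nat where N: "Im z / (- ?h t0) < of_nat N"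
    using reals_Archimedean2 by blast
  show ?thesis
  proof (rule eventually_sequentiallyI[of N], rule ballI)
    fix M t assume "N \<le> M" "t \<in> K"
    have "Im z < of_nat N * (- ?h t0)"
      using N \<open>?h t0 < 0\<close> by (simp only: pos_divide_less_eq neg_0_less_iff_less)
    also have "\<dots> \<le> of_nat M * (- ?h t)"
      by (rule mult_mono) (use \<open>N \<le> M\<close> t0(2)[OF \<open>t \<in> K\<close>] \<open>?h t0 < 0\<close> in auto)
    moreover have "Im (of_nat M / w t) = of_nat M * ?h t"
      using times_complex.sel(2)[of "of_nat M" "1 / w t"] by simp
    ultimately show "Im (z + of_nat M / w t) < 0"
      by simp
  qed
qed simp

text \<open>\<open>z\<close> stays fixed. The weighted symbols \<open>F M\<close> have no zeros near
  \<open>w\<close> and converge to \<open>G\<close>; restriction to a complex line through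
  \<open>w\<close> makes the one-variable theorem of Hurwitz applicable.\<close>

lemma symbol_nonzero:
  fixes a :: "'n::finite weyl_coeffs"
  assumes "a \<noteq> 0"
    and pres: "\<And>g. strictly_stable g \<Longrightarrow> strictly_stable (weyl_operator a g) \<or> weyl_operator a g = 0"
    and z: "\<And>i. Im (z $ i) \<ge> 0" and w: "\<And>i. Im (w $ i) > 0"
  shows "(\<Sum>(\<alpha>, \<beta>)\<in>Poly_Mapping.keys a.
    Poly_Mapping.lookup a (\<alpha>, \<beta>) * vpow z \<alpha> * vpow (- w) \<beta>) \<noteq> 0"
proof
  define F where "F M v = (\<Sum>(\<alpha>, \<beta>)\<in>Poly_Mapping.keys a. Poly_Mapping.lookup a (\<alpha>, \<beta>) * vpow z \<alpha> *
    (vfalling M \<beta> * vpow (\<chi> i. 1 / of_nat M) \<beta> * vpow (- v) \<beta>))" for M v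
  define G where "G v = (\<Sum>(\<alpha>, \<beta>)\<in>Poly_Mapping.keys a.
    Poly_Mapping.lookup a (\<alpha>, \<beta>) * vpow z \<alpha> * vpow (- v) \<beta>)" for v
  assume "(\<Sum>(\<alpha>, \<beta>)\<in>Poly_Mapping.keys a.
    Poly_Mapping.lookup a (\<alpha>, \<beta>) * vpow z \<alpha> * vpow (- w) \<beta>) = 0"
  then have Gw: "G w = 0"
    by (simp add: G_def)

  \<comment> \<open>A crude strict bound for all exponents \<open>\<beta>_i\<close>;
    \<open>Suc\<close> also makes \<open>D\<close> positive.\<close>
  define D where "D = Suc (\<Sum>(\<alpha>, \<beta>)\<in>Poly_Mapping.keys a. \<Sum>i\<in>UNIV. Poly_Mapping.lookup \<beta> i)"
  have deg: "Poly_Mapping.lookup \<beta> i < M" if "(\<alpha>, \<beta>) \<in> Poly_Mapping.keys a" "D \<le> M" for \<alpha> \<beta> i M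
  proof -
    have "Poly_Mapping.lookup \<beta> i \<le> (\<Sum>i\<in>UNIV. Poly_Mapping.lookup \<beta> i)"
      by (rule member_le_sum) auto
    also have "\<dots> \<le> (\<Sum>(\<alpha>, \<beta>)\<in>Poly_Mapping.keys a. \<Sum>i\<in>UNIV. Poly_Mapping.lookup \<beta> i)"
      using member_le_sum[OF that(1), of "\<lambda>(\<alpha>, \<beta>). \<Sum>i\<in>UNIV. Poly_Mapping.lookup \<beta> i"] by simp
    finally show ?thesis
      using that(2) by (simp add: D_def)
  qed
  have F_nonzero: "F M v \<noteq> 0"
    if "D \<le> M" "\<And>i. Im (v $ i) > 0" "\<And>i. Im (z $ i + of_nat M / v $ i) < 0" for M v
    unfolding F_def
  proof (rule rescaled_symbol_nonzero[OF \<open>a \<noteq> 0\<close> _ deg pres z])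
    show "v $ i \<noteq> 0" for i
      using that(2)[of i] by auto
  qed (use that in \<open>auto simp: D_def\<close>)

  \<comment> \<open>If \<open>G\<close> vanished identically for this \<open>z\<close>, all its
    coefficients in \<open>w\<close> would vanish. \<open>F M\<close> has the same coefficients up
    to weights, so it would vanish too, contradicting \<open>F_nonzero\<close> at \<open>w\<close>
    for large \<open>M\<close>.\<close>
  obtain v where v: "G v \<noteq> 0"
  proof (rule ccontr)
    assume "\<not> thesis"
    with that have G0: "G v = 0" for v
      by blast
    have coeff: "(\<Sum>\<alpha>\<in>fst ` Poly_Mapping.keys a. Poly_Mapping.lookup a (\<alpha>, \<beta>) * vpow z \<alpha>) = 0"
      if "\<beta> \<in> snd ` Poly_Mapping.keys a" for \<beta>
      by (rule sum_keys_eq_0_imp[where h = "\<lambda>_. 1"])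
        (use that G0[of "- u" for u] in \<open>simp_all add: G_def\<close>)
    have "F M v = 0" for M v
      unfolding F_def sum_keys_regroup by (rule sum.neutral) (simp add: coeff)
    moreover have "\<forall>\<^sub>F M in sequentially. \<forall>i. \<forall>t\<in>{0 :: complex}. Im (z $ i + of_nat M / w $ i) < 0"
      by (intro eventually_all_finite eventually_Im_add_divide_neg) (use w in auto)
    then obtain N where "\<And>M i. N \<le> M \<Longrightarrow> Im (z $ i + of_nat M / w $ i) < 0"
      by (auto simp: eventually_sequentially)
    then have "F (N + D) w \<noteq> 0"
      by (intro F_nonzero w) (simp_all del: of_nat_add plus_complex.sel)
    ultimately show False
      by simp
  qed

  \<comment> \<open>The complex line with \<open>l 0 = w\<close> and \<open>l 1 = v\<close>. The
    point \<open>v\<close> may lie outside the upper half planes, so only a small disc around 0 is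
    used for Hurwitz.\<close>
  define l where "l t = w + (\<chi> i. t * (v $ i - w $ i))" for t
  have l_hol: "(\<lambda>t. (- l t) $ i) holomorphic_on S" for i S
    unfolding l_def by (auto intro!: holomorphic_intros)
  have l_cont: "continuous_on S (\<lambda>t. l t $ i)" for i S
    unfolding l_def by (auto intro!: continuous_intros)
  have l0: "l 0 = w" and l1: "l 1 = v"
    by (simp_all add: l_def vec_eq_iff)

  have "open (\<Inter>i. {t. 0 < Im (l t $ i)})"
    by (intro open_INT ballI open_Collect_less continuous_on_Im l_cont) simp_all
  moreover have "0 \<in> (\<Inter>i. {t. 0 < Im (l t $ i)})"
    by (simp add: l0 w)
  ultimately obtain r where r: "r > 0" and "cball 0 r \<subseteq> (\<Inter>i. {t. 0 < Im (l t $ i)})"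
    by (meson open_contains_cball)
  then have l_pos: "Im (l t $ i) > 0" if "t \<in> cball 0 r" for t i
    using that by blast

  have "\<forall>\<^sub>F M in sequentially. \<forall>i. \<forall>t\<in>cball 0 r. Im (z $ i + of_nat M / l t $ i) < 0"
    by (intro eventually_all_finite eventually_Im_add_divide_neg l_cont l_pos) auto
  then obtain N where N: "\<And>M t i. N \<le> M \<Longrightarrow> t \<in> cball 0 r \<Longrightarrow> Im (z $ i + of_nat M / l t $ i) < 0"
    unfolding eventually_sequentially by blast

  have G_hol: "(\<lambda>t. G (l t)) holomorphic_on S" for S
    unfolding G_def case_prod_unfold by (intro holomorphic_intros holomorphic_on_vpow l_hol)
  have F_hol: "(\<lambda>t. F M (l t)) holomorphic_on S" for S M
    unfolding F_def case_prod_unfold by (intro holomorphic_intros holomorphic_on_vpow l_hol)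
  have "G (l 0) \<noteq> 0"
  \<comment> \<open>The shift by \<open>N + D\<close> puts every member of the sequence beyond both
    thresholds.\<close>
  proof (rule Hurwitz_no_zeros[where S = "ball 0 r" and \<F> = "\<lambda>n t. F (n + (N + D)) (l t)"
        and g = "\<lambda>t. G (l t)"])
    show "uniform_limit K (\<lambda>n t. F (n + (N + D)) (l t)) (\<lambda>t. G (l t)) sequentially"
      if "compact K" for K
    proof -
      let ?q = "\<lambda>(\<alpha>, \<beta>). Poly_Mapping.lookup a (\<alpha>, \<beta>) * vpow z \<alpha>"
      have lim: "(\<lambda>n. ?q k * (vfalling (n + (N + D)) (snd k) *
          vpow (\<chi> i. 1 / of_nat (n + (N + D))) (snd k))) \<longlonglongrightarrow> ?q k * 1" for k
        by (intro tendsto_intros LIMSEQ_ignore_initial_segment[OF tendsto_vfalling])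
      have "continuous_on K (\<lambda>t. vpow (- l t) (snd k))" for k :: "'n multi_index \<times> 'n multi_index"
        by (intro holomorphic_on_imp_continuous_on holomorphic_on_vpow l_hol)
      then have "bounded ((\<lambda>t. vpow (- l t) (snd k)) ` K)" for k :: "'n multi_index \<times> 'n multi_index"
        by (intro compact_imp_bounded compact_continuous_image that)
      from uniform_limit_coeff_sum[OF finite_keys lim this]
      show ?thesis
        unfolding F_def G_def by (simp add: case_prod_unfold mult.assoc)
    qed
    show "\<not> (\<lambda>t. G (l t)) constant_on ball 0 r"
    proof
      assume "(\<lambda>t. G (l t)) constant_on ball 0 r"
      then have "G (l t) = 0" if "t \<in> ball 0 r" for t
        using that r Gw l0 unfolding constant_on_def by (metis centre_in_ball)
      \<comment> \<open>A constant value on the disc would be \<open>G w = 0\<close>; since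
        \<open>G (l t)\<close> is entire in \<open>t\<close>, the identity theorem carries this zero
        value to \<open>t = 1\<close>, where \<open>G v \<noteq> 0\<close>.\<close>
      then have "G (l 1) = 0"
        using analytic_continuation_open[of "ball 0 r" UNIV "\<lambda>t. G (l t)" "\<lambda>_. 0" 1] r G_hol
        by (simp add: convex_connected)
      with v l1 show False by simp
    qed
    show "F (n + (N + D)) (l t) \<noteq> 0" if "t \<in> ball 0 r" for n t
    proof (rule F_nonzero)
      have t: "t \<in> cball 0 r"
        using that by simp
      show "Im (l t $ i) > 0" for i
        by (rule l_pos[OF t])
      show "Im (z $ i + of_nat (n + (N + D)) / l t $ i) < 0" for i
        by (rule N[OF _ t]) simp
    qed simp
  qed (use r G_hol F_hol in auto)
  with Gw l0 show False by simp
qed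

theorem theorem5p1:
  fixes T :: "'n::finite cpoly \<Rightarrow> 'n cpoly"
  assumes "T \<in> weyl_algebra" and "T \<noteq> (\<lambda>p. 0)"
    and "T \<in> strict_stability_preservers"
  shows "\<forall>z w. (\<forall>j. Im (z $ j) \<ge> 0) \<and> (\<forall>k. Im (w $ k) > 0) \<longrightarrow> weyl_symbol T z (- w) \<noteq> 0"
proof -
  obtain a where T: "T = weyl_operator a"
    using assms(1) by (auto simp: weyl_algebra_def)
  have "a \<noteq> 0"
    using assms(2) by (auto simp: T weyl_operator_def)
  moreover have "strictly_stable (weyl_operator a g) \<or> weyl_operator a g = 0" if "strictly_stable g" for g
    using assms(3) that
    by (auto simp: strict_stability_preservers_def strictly_stable_polys_def T)
  \<comment> \<open>Uniqueness of the normal form identifies \<open>weyl_coeffs T\<close> with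
    \<open>a\<close>.\<close>
  ultimately show ?thesis
    using symbol_nonzero[of a] by (simp add: weyl_symbol_def T weyl_coeffs_weyl_operator)
qed

end
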